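(* Let $G$ be a connected graph with at least $2$ vertices and $H$ a connected graph. Then \[F(G+_Q H)=|V(H)|F(G)+|V(G)|F(H)+6|E(H)|M_1(G)+6|E(G)|M_1(H)+|V(H)|\xi_4(G)+3|V(H)|\,\mathrm{ReZM}(G).\]
   Context: All graphs are finite, simple and undirected; $d_G(v)$ denotes degree. $F(G)=\sum_{v\in V(G)}d_G(v)^3$, $M_1(G)=\sum_{v\in V(G)}d_G(v)^2$, $\xi_4(G)=\sum_{v\in V(G)}d_G(v)^4$, and $\mathrm{ReZM}(G)=\sum_{uv\in E(G)}d_G(u)d_G(v)[d_G(u)+d_G(v)]$. The line superposition graph $Q(G)$ has vertex set $V(G)\cup E(G)$ and is obtained from $G$ by inserting a new vertex into each edge of $G$ (so each edge $e=uv$ becomes the path $u\,e\,v$) and then joining by edges each pair of new vertices lying on adjacent edges of $G$. The $Q$-sum $G+_Q H$ is the graph with vertex set $(V(G)\cup E(G))\times V(H)$ in which $(u,v)$ and $(u',v')$ are adjacent if and only if [$u=u'\in V(G)$ and $vv'\in E(H)$] or [$v=v'$ and $uu'\in E(Q(G))$]. *)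

theory Defs
  imports Main
begin

record 'a sgraph =
  verts :: "'a set"
  edges :: "'a set set"

definition simple_graph :: "'a sgraph \<Rightarrow> bool" where
  "simple_graph G \<longleftrightarrow> finite (verts G) \<and> (\<forall>e\<in>edges G. e \<subseteq> verts G \<and> card e = 2)"

definition adjacent :: "'a sgraph \<Rightarrow> 'a \<Rightarrow> 'a \<Rightarrow> bool" where
  "adjacent G u v \<longleftrightarrow> {u, v} \<in> edges G"

(* The null graph does not count as connected. *)
definition connected_graph :: "'a sgraph \<Rightarrow> bool" where
  "connected_graph G \<longleftrightarrow> simple_graph G \<and> verts G \<noteq> {} \<and>
     (\<forall>u\<in>verts G. \<forall>v\<in>verts G. (adjacent G)\<^sup>*\<^sup>* u v)"

definition degree :: "'a sgraph \<Rightarrow> 'a \<Rightarrow> nat" where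
  "degree G v = card {u \<in> verts G. adjacent G v u}"

definition F_index :: "'a sgraph \<Rightarrow> nat" where
  "F_index G = (\<Sum>v\<in>verts G. degree G v ^ 3)"

definition M1_index :: "'a sgraph \<Rightarrow> nat" where
  "M1_index G = (\<Sum>v\<in>verts G. degree G v ^ 2)"

definition xi4_index :: "'a sgraph \<Rightarrow> nat" where
  "xi4_index G = (\<Sum>v\<in>verts G. degree G v ^ 4)"

(* For an edge e = {u, v} with u \<noteq> v, the summand is d(u) d(v) (d(u) + d(v)). *)
definition ReZM_index :: "'a sgraph \<Rightarrow> nat" where
  "ReZM_index G = (\<Sum>e\<in>edges G. (\<Prod>w\<in>e. degree G w) * (\<Sum>w\<in>e. degree G w))"

(* Inl u is the original vertex u; Inr e is the new vertex inserted into the edge e. *)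
definition Q_graph :: "'a sgraph \<Rightarrow> ('a + 'a set) sgraph" where
  "Q_graph G = \<lparr>
     verts = Inl ` verts G \<union> Inr ` edges G,
     edges = {{Inl u, Inr e} | u e. e \<in> edges G \<and> u \<in> e}
           \<union> {{Inr e, Inr f} | e f. e \<in> edges G \<and> f \<in> edges G \<and> e \<noteq> f \<and> e \<inter> f \<noteq> {}} \<rparr>"

definition Q_sum :: "'a sgraph \<Rightarrow> 'b sgraph \<Rightarrow> (('a + 'a set) \<times> 'b) sgraph"
    (infixl \<open>+\<^sub>Q\<close> 65) where
  "G +\<^sub>Q H = \<lparr>
     verts = verts (Q_graph G) \<times> verts H,
     edges = {{(x, v), (y, w)} | x v y w.
                x \<in> verts (Q_graph G) \<and> y \<in> verts (Q_graph G) \<and> v \<in> verts H \<and> w \<in> verts H \<and>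
                ((x = y \<and> x \<in> Inl ` verts G \<and> adjacent H v w) \<or>
                 (v = w \<and> adjacent (Q_graph G) x y))} \<rparr>"

lemma simple_graph_Q_graph:
  assumes "simple_graph G"
  shows "simple_graph (Q_graph G)"
proof -
  have "edges G \<subseteq> Pow (verts G)"
    using assms by (auto simp: simple_graph_def)
  then have "finite (edges G)"
    using assms by (meson finite_Pow_iff finite_subset simple_graph_def)
  then show ?thesis
    using assms by (fastforce simp: simple_graph_def Q_graph_def card_2_iff)
qed

lemma adjacent_sym: "adjacent G u v \<longleftrightarrow> adjacent G v u"
  by (simp add: adjacent_def insert_commute)

lemma adjacent_imp_neq:
  assumes "simple_graph G" and "adjacent G u v"
  shows "u \<noteq> v"
  using assms by (auto simp: simple_graph_def adjacent_def)

lemma simple_graph_Q_sum: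
  assumes G: "simple_graph G" and H: "simple_graph H"
  shows "simple_graph (G +\<^sub>Q H)"
proof -
  have "e \<subseteq> verts (G +\<^sub>Q H) \<and> card e = 2" if "e \<in> edges (G +\<^sub>Q H)" for e
  proof -
    from that obtain x v y w where e: "e = {(x, v), (y, w)}"
      and mem: "x \<in> verts (Q_graph G)" "y \<in> verts (Q_graph G)" "v \<in> verts H" "w \<in> verts H"
      and adj: "(x = y \<and> adjacent H v w) \<or> (v = w \<and> adjacent (Q_graph G) x y)"
      by (auto simp: Q_sum_def)
    have "(x, v) \<noteq> (y, w)"
      using adj adjacent_imp_neq[OF H] adjacent_imp_neq[OF simple_graph_Q_graph[OF G]] by blast
    with e mem show ?thesis
      by (simp add: Q_sum_def)
  qed
  moreover have "finite (verts (G +\<^sub>Q H))"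
    using simple_graph_Q_graph[OF G] H by (simp add: simple_graph_def Q_sum_def)
  ultimately show ?thesis
    by (simp add: simple_graph_def)
qed

lemma adjacent_Q_sum:
  "adjacent (G +\<^sub>Q H) (x, v) (y, w) \<longleftrightarrow>
    x \<in> verts (Q_graph G) \<and> y \<in> verts (Q_graph G) \<and> v \<in> verts H \<and> w \<in> verts H \<and>
    ((x = y \<and> x \<in> Inl ` verts G \<and> adjacent H v w) \<or>
     (v = w \<and> adjacent (Q_graph G) x y))"
  (is "?L \<longleftrightarrow> ?R x v y w")
proof -
  have "?L \<longleftrightarrow> (\<exists>x' v' y' w'. {(x, v), (y, w)} = {(x', v'), (y', w')} \<and> ?R x' v' y' w')"
    unfolding adjacent_def[of "G +\<^sub>Q H"] unfolding Q_sum_def by simp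
  also have "\<dots> \<longleftrightarrow> ?R x v y w \<or> ?R y w x v"
    unfolding doubleton_eq_iff prod.inject by blast
  also have "\<dots> \<longleftrightarrow> ?R x v y w"
    using adjacent_sym[of H v w] adjacent_sym[of "Q_graph G" x y] by blast
  finally show ?thesis .
qed

end

(* In the Q-sum the vertex (u, v) with u in V(G) has degree d(u) + d(v), and the vertex (e, v)
   with e = ab in E(G) has degree d(a) + d(b), because any edge other than e meets e in at most
   one end.  Expanding the cubes, the mixed terms of the first kind are evaluated with the
   handshake identity; for the second kind,
   (d(a) + d(b))^3 = d(a)^3 + d(b)^3 + 3 d(a) d(b) (d(a) + d(b)),
   and summing d(a)^3 + d(b)^3 over the edges counts d(u)^3 once for each edge at u. *)
theory Submission
  imports Defs
begin

definition incident_edges :: "'a sgraph \<Rightarrow> 'a \<Rightarrow> 'a set set" where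
  "incident_edges G v = {e \<in> edges G. v \<in> e}"

lemma finite_edges:
  assumes "simple_graph G"
  shows "finite (edges G)"
proof -
  have "edges G \<subseteq> Pow (verts G)" "finite (verts G)"
    using assms by (auto simp: simple_graph_def)
  then show ?thesis
    by (meson finite_Pow_iff finite_subset)
qed

lemma edge_cases:
  assumes "simple_graph G" "e \<in> edges G"
  obtains a b where "e = {a, b}" "a \<noteq> b" "a \<in> verts G" "b \<in> verts G"
proof -
  have "card e = 2" "e \<subseteq> verts G"
    using assms by (auto simp: simple_graph_def)
  then show ?thesis
    using that by (auto simp: card_2_iff)
qed

text \<open>A neighbour \<open>u\<close> of \<open>v\<close> corresponds to the edge
  \<open>{v, u}\<close>. Counting edges instead of neighbours suits \<open>Q_graph G\<close>, where
  the neighbours of \<open>Inl v\<close> are edges of \<open>G\<close>.\<close>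

lemma degree_eq_card_incident_edges:
  assumes "simple_graph G"
  shows "degree G v = card (incident_edges G v)"
proof -
  have "bij_betw (\<lambda>u. {v, u}) {u \<in> verts G. adjacent G v u} (incident_edges G v)"
  proof (rule bij_betw_imageI)
    show "inj_on (\<lambda>u. {v, u}) {u \<in> verts G. adjacent G v u}"
      by (auto intro!: inj_onI simp: doubleton_eq_iff)
    show "(\<lambda>u. {v, u}) ` {u \<in> verts G. adjacent G v u} = incident_edges G v"
    proof (intro equalityI subsetI)
      fix e
      assume "e \<in> incident_edges G v"
      then have e: "e \<in> edges G" "v \<in> e"
        by (auto simp: incident_edges_def)
      then obtain a b where "e = {a, b}" "a \<in> verts G" "b \<in> verts G"
        using edge_cases assms by metis
      with e show "e \<in> (\<lambda>u. {v, u}) ` {u \<in> verts G. adjacent G v u}"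
        by (auto simp: adjacent_def insert_commute)
    qed (auto simp: adjacent_def incident_edges_def)
  qed
  then show ?thesis
    by (simp add: degree_def bij_betw_same_card)
qed

text \<open>Double counting of incident pairs of a vertex and an edge. The constant weight 1 gives
  the handshake identity, and the weight \<open>degree G w ^ 3\<close> gives
  \<open>xi4_index G\<close>.\<close>

lemma sum_edges_sum_ends:
  fixes f :: "'a \<Rightarrow> nat"
  assumes G: "simple_graph G"
  shows "(\<Sum>e\<in>edges G. \<Sum>w\<in>e. f w) = (\<Sum>v\<in>verts G. degree G v * f v)"
proof -
  \<comment> \<open>Writing the ends of \<open>e\<close> as a restriction of the fixed set
    \<open>verts G\<close> allows the two sums to be exchanged.\<close>
  have "(\<Sum>e\<in>edges G. \<Sum>w\<in>e. f w) = (\<Sum>e\<in>edges G. \<Sum>w\<in>{w \<in> verts G. w \<in> e}. f w)"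
    using G by (intro sum.cong refl) (auto simp: simple_graph_def)
  also have "\<dots> = (\<Sum>v\<in>verts G. \<Sum>e\<in>{e \<in> edges G. v \<in> e}. f v)"
    using G finite_edges[OF G] by (intro sum.swap_restrict) (auto simp: simple_graph_def)
  also have "\<dots> = (\<Sum>v\<in>verts G. degree G v * f v)"
    by (simp add: degree_eq_card_incident_edges[OF G] incident_edges_def)
  finally show ?thesis .
qed

lemma sum_degree:
  assumes "simple_graph G"
  shows "(\<Sum>v\<in>verts G. degree G v) = 2 * card (edges G)"
proof -
  have "(\<Sum>v\<in>verts G. degree G v) = (\<Sum>e\<in>edges G. \<Sum>w\<in>e. 1)"
    using sum_edges_sum_ends[OF assms, of "\<lambda>_. 1"] by simp
  also have "\<dots> = (\<Sum>e\<in>edges G. 2)"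
    using assms by (intro sum.cong) (auto simp: simple_graph_def)
  finally show ?thesis
    by simp
qed

lemma verts_Q_graph: "verts (Q_graph G) = Inl ` verts G \<union> Inr ` edges G"
  by (simp add: Q_graph_def)

lemma verts_Q_sum: "verts (G +\<^sub>Q H) = verts (Q_graph G) \<times> verts H"
  by (simp add: Q_sum_def)

lemma adjacent_Q_graph_simps:
  "\<not> adjacent (Q_graph G) (Inl u) (Inl v)"
  "adjacent (Q_graph G) (Inl u) (Inr e) \<longleftrightarrow> e \<in> edges G \<and> u \<in> e"
  "adjacent (Q_graph G) (Inr e) (Inl u) \<longleftrightarrow> e \<in> edges G \<and> u \<in> e"
  "adjacent (Q_graph G) (Inr e) (Inr f) \<longleftrightarrow>
    e \<in> edges G \<and> f \<in> edges G \<and> e \<noteq> f \<and> e \<inter> f \<noteq> {}"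
  by (auto simp: adjacent_def Q_graph_def doubleton_eq_iff)

lemma degree_Q_graph_Inl:
  assumes "simple_graph G"
  shows "degree (Q_graph G) (Inl u) = degree G u"
proof -
  have "{x \<in> verts (Q_graph G). adjacent (Q_graph G) (Inl u) x} = Inr ` incident_edges G u"
    by (auto simp: adjacent_Q_graph_simps incident_edges_def verts_Q_graph)
  then show ?thesis
    by (simp add: degree_def[of "Q_graph G"] degree_eq_card_incident_edges[OF assms] card_image)
qed

text \<open>At each end \<open>w\<close> of \<open>e\<close> there are \<open>degree G w - 1\<close>
  edges other than \<open>e\<close>; the end itself, also a neighbour of \<open>Inr e\<close>, makes
  up for the missing one.\<close>

lemma degree_Q_graph_Inr:
  assumes G: "simple_graph G" and e: "e \<in> edges G"
  shows "degree (Q_graph G) (Inr e) = (\<Sum>w\<in>e. degree G w)"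
proof -
  obtain a b where ab: "e = {a, b}" "a \<noteq> b" "a \<in> verts G" "b \<in> verts G"
    using edge_cases[OF G e] by metis
  define A where "A = incident_edges G a - {e}"
  define B where "B = incident_edges G b - {e}"
  have fin: "finite (incident_edges G w)" for w
    using finite_edges[OF G] by (simp add: incident_edges_def)
  \<comment> \<open>The \<open>Suc\<close> accounts for \<open>e\<close>, which is incident with
    both \<open>a\<close> and \<open>b\<close>; this form avoids truncated subtraction.\<close>
  have deg: "degree G a = Suc (card A)" "degree G b = Suc (card B)"
    using card.remove[OF fin, of e a] card.remove[OF fin, of e b] e ab(1)
    by (auto simp: degree_eq_card_incident_edges[OF G] A_def B_def incident_edges_def
        simp del: card_Diff_insert)
  have "A \<inter> B = {}"
  proof -
    have "f = e" if "f \<in> edges G" "a \<in> f" "b \<in> f" for f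
      using edge_cases[OF G that(1)] that(2,3) ab by (metis doubleton_eq_iff empty_iff insert_iff)
    then show ?thesis
      by (auto simp: A_def B_def incident_edges_def)
  qed
  then have "card (A \<union> B) = card A + card B"
    using fin by (intro card_Un_disjoint) (auto simp: A_def B_def)
  moreover have "{x \<in> verts (Q_graph G). adjacent (Q_graph G) (Inr e) x}
      = Inl ` {a, b} \<union> Inr ` (A \<union> B)" (is "?N = ?M")
  proof (intro set_eqI)
    fix x
    show "x \<in> ?N \<longleftrightarrow> x \<in> ?M"
      using ab e by (cases x)
        (auto simp: adjacent_Q_graph_simps A_def B_def incident_edges_def verts_Q_graph)
  qed
  moreover have "card (Inl ` {a, b} \<union> Inr ` (A \<union> B) :: ('a + 'a set) set)
      = card {a, b} + card (A \<union> B)"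
    using fin ab(2) by (subst card_Un_disjoint) (auto simp: card_image A_def B_def)
  ultimately show ?thesis
    using ab deg by (simp add: degree_def[of "Q_graph G"])
qed

lemma degree_Q_sum_Inl:
  assumes G: "simple_graph G" and H: "simple_graph H" and u: "u \<in> verts G" and v: "v \<in> verts H"
  shows "degree (G +\<^sub>Q H) (Inl u, v) = degree G u + degree H v"
proof -
  let ?A = "{x \<in> verts (Q_graph G). adjacent (Q_graph G) (Inl u) x}"
  let ?B = "{w \<in> verts H. adjacent H v w}"
  have "{p \<in> verts (G +\<^sub>Q H). adjacent (G +\<^sub>Q H) (Inl u, v) p}
      = (\<lambda>x. (x, v)) ` ?A \<union> Pair (Inl u) ` ?B"
    using u v by (auto simp: adjacent_Q_sum verts_Q_sum verts_Q_graph)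
  \<comment> \<open>A common element could only be \<open>(Inl u, v)\<close>, but
    \<open>Inl u\<close> is not adjacent to itself in \<open>Q_graph G\<close>.\<close>
  moreover have "card ((\<lambda>x. (x, v)) ` ?A \<union> Pair (Inl u) ` ?B) = card ?A + card ?B"
    using simple_graph_Q_graph[OF G] H
    by (subst card_Un_disjoint)
      (auto simp: card_image inj_on_def simple_graph_def adjacent_Q_graph_simps)
  ultimately show ?thesis
    using degree_Q_graph_Inl[OF G, of u] by (simp add: degree_def)
qed

lemma degree_Q_sum_Inr:
  assumes G: "simple_graph G" and e: "e \<in> edges G" and v: "v \<in> verts H"
  shows "degree (G +\<^sub>Q H) (Inr e, v) = (\<Sum>w\<in>e. degree G w)"
proof -
  let ?A = "{x \<in> verts (Q_graph G). adjacent (Q_graph G) (Inr e) x}"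
  \<comment> \<open>Edges of \<open>H\<close> are copied only over original vertices, so every
    neighbour of \<open>(Inr e, v)\<close> lies in the same copy of
    \<open>Q_graph G\<close>.\<close>
  have "{p \<in> verts (G +\<^sub>Q H). adjacent (G +\<^sub>Q H) (Inr e, v) p} = (\<lambda>x. (x, v)) ` ?A"
    using e v by (auto simp: adjacent_Q_sum verts_Q_sum verts_Q_graph)
  then show ?thesis
    using degree_Q_graph_Inr[OF G e] by (simp add: degree_def card_image inj_on_def)
qed

text \<open>The binomial expansion, with each mixed double sum factoring into a product. For
  degrees, the handshake identity turns the linear sums into twice the numbers of edges, so the
  coefficient 3 becomes 6.\<close>

lemma sum_add_cubed:
  fixes f :: "'a \<Rightarrow> nat" and g :: "'b \<Rightarrow> nat"
  shows "(\<Sum>x\<in>A. \<Sum>y\<in>B. (f x + g y) ^ 3)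
    = card B * (\<Sum>x\<in>A. f x ^ 3) + card A * (\<Sum>y\<in>B. g y ^ 3)
      + 3 * (\<Sum>y\<in>B. g y) * (\<Sum>x\<in>A. f x ^ 2) + 3 * (\<Sum>x\<in>A. f x) * (\<Sum>y\<in>B. g y ^ 2)"
proof -
  have "(f x + g y) ^ 3 = f x ^ 3 + g y ^ 3 + 3 * (f x ^ 2 * g y) + 3 * (f x * g y ^ 2)" for x y
    by (simp add: power2_eq_square power3_eq_cube algebra_simps)
  then have "(\<Sum>x\<in>A. \<Sum>y\<in>B. (f x + g y) ^ 3)
    = card B * (\<Sum>x\<in>A. f x ^ 3) + card A * (\<Sum>y\<in>B. g y ^ 3)
      + 3 * (\<Sum>x\<in>A. \<Sum>y\<in>B. f x ^ 2 * g y) + 3 * (\<Sum>x\<in>A. \<Sum>y\<in>B. f x * g y ^ 2)"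
    by (simp add: sum.distrib sum_distrib_left)
  then show ?thesis
    by (simp add: sum_product[symmetric])
qed

lemma sum_edges_degree_sum_cubed:
  assumes G: "simple_graph G"
  shows "(\<Sum>e\<in>edges G. (\<Sum>w\<in>e. degree G w) ^ 3) = xi4_index G + 3 * ReZM_index G"
proof -
  have "(\<Sum>w\<in>e. degree G w) ^ 3
      = (\<Sum>w\<in>e. degree G w ^ 3) + 3 * ((\<Prod>w\<in>e. degree G w) * (\<Sum>w\<in>e. degree G w))"
    if "e \<in> edges G" for e
  proof -
    obtain a b where "e = {a, b}" "a \<noteq> b"
      using edge_cases[OF G \<open>e \<in> edges G\<close>] by metis
    then show ?thesis
      by (simp add: power3_eq_cube algebra_simps)
  qed
  then have "(\<Sum>e\<in>edges G. (\<Sum>w\<in>e. degree G w) ^ 3)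
      = (\<Sum>e\<in>edges G. \<Sum>w\<in>e. degree G w ^ 3) + 3 * ReZM_index G"
    by (simp add: sum.distrib sum_distrib_left ReZM_index_def)
  also have "(\<Sum>e\<in>edges G. \<Sum>w\<in>e. degree G w ^ 3) = xi4_index G"
    \<comment> \<open>The weight \<open>degree G v\<close> from double counting raises the cube to a
      fourth power.\<close>
    by (simp add: sum_edges_sum_ends[OF G] xi4_index_def power_Suc[symmetric] del: power_Suc)
  finally show ?thesis .
qed

theorem theorem4:
  fixes G :: "'a sgraph" and H :: "'b sgraph"
  assumes "connected_graph G" and "card (verts G) \<ge> 2" and "connected_graph H"
  shows "F_index (G +\<^sub>Q H) =
    card (verts H) * F_index G + card (verts G) * F_index H
    + 6 * card (edges H) * M1_index G + 6 * card (edges G) * M1_index H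
    + card (verts H) * xi4_index G + 3 * card (verts H) * ReZM_index G"
proof -
  have G: "simple_graph G" and H: "simple_graph H"
    using assms by (auto simp: connected_graph_def)
  let ?d = "\<lambda>x v. degree (G +\<^sub>Q H) (x, v)"
  have "F_index (G +\<^sub>Q H) = (\<Sum>x\<in>Inl ` verts G \<union> Inr ` edges G. \<Sum>v\<in>verts H. ?d x v ^ 3)"
    by (simp add: F_index_def verts_Q_sum verts_Q_graph sum.cartesian_product)
  also have "\<dots> = (\<Sum>x\<in>Inl ` verts G. \<Sum>v\<in>verts H. ?d x v ^ 3)
      + (\<Sum>x\<in>Inr ` edges G. \<Sum>v\<in>verts H. ?d x v ^ 3)"
    using G finite_edges[OF G] by (intro sum.union_disjoint) (auto simp: simple_graph_def)
  also have "(\<Sum>x\<in>Inl ` verts G. \<Sum>v\<in>verts H. ?d x v ^ 3)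
      = (\<Sum>u\<in>verts G. \<Sum>v\<in>verts H. (degree G u + degree H v) ^ 3)"
    by (simp add: sum.reindex degree_Q_sum_Inl[OF G H])
  \<comment> \<open>The degree of \<open>(Inr e, v)\<close> does not depend on \<open>v\<close>, so
    each edge contributes the same cube \<open>card (verts H)\<close> times.\<close>
  also have "(\<Sum>x\<in>Inr ` edges G. \<Sum>v\<in>verts H. ?d x v ^ 3)
      = card (verts H) * (\<Sum>e\<in>edges G. (\<Sum>w\<in>e. degree G w) ^ 3)"
    by (simp add: sum.reindex degree_Q_sum_Inr[OF G] sum_distrib_left)
  finally show ?thesis
    by (simp add: sum_add_cubed sum_degree[OF G] sum_degree[OF H]
        sum_edges_degree_sum_cubed[OF G] F_index_def M1_index_def algebra_simps)
qed

end
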